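(* Let $\Omega\subset\mathbb{H}$ be a symmetric slice domain, let $I_0,J_0\in\mathbb{S}$ with $I_0\neq\pm J_0$, and let $f,h:\Omega\rightarrow \mathbb{H}$ be two slice regular functions, neither of which is slice preserving, such that $f=f_{0}+f_{1}I_{0}$ is $\mathbb{C}_{I_{0}}$-preserving and $h=h_{0}+h_{1}J_{0}$ is $\mathbb{C}_{J_{0}}$-preserving, with $f_{0},f_{1},h_{0},h_{1}$ slice preserving functions. Let $K_0\in\mathbb{S}$. Then $f+h$ is $\mathbb{C}_{K_{0}}$-preserving if and only if there exist $a, b \in\mathbb{R}\setminus\{0\}$ such that $K_0=a I_0+ b J_0$ and $b f_1-a h_1\equiv0$.
   Context: $\mathbb{H}$ is the algebra of quaternions, $\mathbb{S}=\{q\in\mathbb{H}: q^2=-1\}$, and $\mathbb{C}_I=\mathrm{Span}_{\mathbb{R}}(1,I)$ for $I\in\mathbb{S}$. A symmetric slice domain $\Omega\subset\mathbb{H}$ is a domain (connected open set) such that $\Omega\cap\mathbb{R}\neq\emptyset$ and, whenever $\alpha+I\beta\in\Omega$ ($\alpha,\beta\in\mathbb{R}$, $I\in\mathbb{S}$), also $\alpha+J\beta\in\Omega$ for all $J\in\mathbb{S}$. A function $f:\Omega\to\mathbb{H}$ is slice regular if for every $J\in\mathbb{S}$ the restriction $f_J$ of $f$ to $\Omega\cap\mathbb{C}_J$ is holomorphic: $\frac12\left(\frac{\partial}{\partial\alpha}+J\frac{\partial}{\partial\beta}\right)f_J(\alpha+J\beta)\equiv0$. A slice regular $f$ is slice preserving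 if $f(\Omega\cap\mathbb{C}_I)\subset\mathbb{C}_I$ for all $I\in\mathbb{S}$, and $\mathbb{C}_J$-preserving if $f(\Omega\cap\mathbb{C}_J)\subset\mathbb{C}_J$. Known fact: every $\mathbb{C}_{J}$-preserving $f$ is written uniquely as $f=f_0+f_1J$ with $f_0,f_1$ slice preserving. *)

theory Defs
  imports "HOL-Analysis.Analysis"
begin

section \<open>The normed algebra of quaternions\<close>

datatype quat = Quat (qRe: real) (qIm1: real) (qIm2: real) (qIm3: real)

lemma quat_eqI:
  "qRe p = qRe q \<Longrightarrow> qIm1 p = qIm1 q \<Longrightarrow> qIm2 p = qIm2 q \<Longrightarrow> qIm3 p = qIm3 q \<Longrightarrow> p = q"
  by (rule quat.expand) simp

lemma quat_eq_iff:
  "p = q \<longleftrightarrow> qRe p = qRe q \<and> qIm1 p = qIm1 q \<and> qIm2 p = qIm2 q \<and> qIm3 p = qIm3 q"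
  by (auto intro: quat_eqI)

instantiation quat :: ab_group_add
begin

definition "0 = Quat 0 0 0 0"
definition "p + q = Quat (qRe p + qRe q) (qIm1 p + qIm1 q) (qIm2 p + qIm2 q) (qIm3 p + qIm3 q)"
definition "- q = Quat (- qRe q) (- qIm1 q) (- qIm2 q) (- qIm3 q)"
definition "p - q = Quat (qRe p - qRe q) (qIm1 p - qIm1 q) (qIm2 p - qIm2 q) (qIm3 p - qIm3 q)"

lemma quat_add_sel [simp]:
  "qRe 0 = 0" "qIm1 0 = 0" "qIm2 0 = 0" "qIm3 0 = 0"
  "qRe (p + q) = qRe p + qRe q" "qIm1 (p + q) = qIm1 p + qIm1 q"
  "qIm2 (p + q) = qIm2 p + qIm2 q" "qIm3 (p + q) = qIm3 p + qIm3 q"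
  "qRe (- q) = - qRe q" "qIm1 (- q) = - qIm1 q" "qIm2 (- q) = - qIm2 q" "qIm3 (- q) = - qIm3 q"
  "qRe (p - q) = qRe p - qRe q" "qIm1 (p - q) = qIm1 p - qIm1 q"
  "qIm2 (p - q) = qIm2 p - qIm2 q" "qIm3 (p - q) = qIm3 p - qIm3 q"
  by (simp_all add: zero_quat_def plus_quat_def uminus_quat_def minus_quat_def)

instance
  by standard (simp_all add: quat_eq_iff)

end

instantiation quat :: real_algebra_1
begin

definition "1 = Quat 1 0 0 0"

definition "p * q = Quat
  (qRe p * qRe q - qIm1 p * qIm1 q - qIm2 p * qIm2 q - qIm3 p * qIm3 q)
  (qRe p * qIm1 q + qIm1 p * qRe q + qIm2 p * qIm3 q - qIm3 p * qIm2 q)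
  (qRe p * qIm2 q - qIm1 p * qIm3 q + qIm2 p * qRe q + qIm3 p * qIm1 q)
  (qRe p * qIm3 q + qIm1 p * qIm2 q - qIm2 p * qIm1 q + qIm3 p * qRe q)"

definition "r *\<^sub>R q = Quat (r * qRe q) (r * qIm1 q) (r * qIm2 q) (r * qIm3 q)"

lemma quat_mult_sel [simp]:
  "qRe 1 = 1" "qIm1 1 = 0" "qIm2 1 = 0" "qIm3 1 = 0"
  "qRe (p * q) = qRe p * qRe q - qIm1 p * qIm1 q - qIm2 p * qIm2 q - qIm3 p * qIm3 q"
  "qIm1 (p * q) = qRe p * qIm1 q + qIm1 p * qRe q + qIm2 p * qIm3 q - qIm3 p * qIm2 q"
  "qIm2 (p * q) = qRe p * qIm2 q - qIm1 p * qIm3 q + qIm2 p * qRe q + qIm3 p * qIm1 q"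
  "qIm3 (p * q) = qRe p * qIm3 q + qIm1 p * qIm2 q - qIm2 p * qIm1 q + qIm3 p * qRe q"
  "qRe (r *\<^sub>R q) = r * qRe q" "qIm1 (r *\<^sub>R q) = r * qIm1 q"
  "qIm2 (r *\<^sub>R q) = r * qIm2 q" "qIm3 (r *\<^sub>R q) = r * qIm3 q"
  by (simp_all add: one_quat_def times_quat_def scaleR_quat_def)

instance
  by standard (simp_all add: quat_eq_iff algebra_simps)

end

instantiation quat :: real_inner
begin

definition "inner p q = qRe p * qRe q + qIm1 p * qIm1 q + qIm2 p * qIm2 q + qIm3 p * qIm3 q"
definition "norm (q::quat) = sqrt (inner q q)"
definition "sgn (q::quat) = q /\<^sub>R norm q"
definition "dist (p::quat) q = norm (p - q)"
definition "(uniformity :: (quat \<times> quat) filter) = (INF e\<in>{0<..}. principal {(x, y). dist x y < e})"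
definition "open (U :: quat set) \<longleftrightarrow> (\<forall>x\<in>U. eventually (\<lambda>(x', y). x' = x \<longrightarrow> y \<in> U) uniformity)"

instance
proof
  fix p q r :: quat and a :: real
  show "dist p q = norm (p - q)" by (rule dist_quat_def)
  show "sgn q = q /\<^sub>R norm q" by (rule sgn_quat_def)
  show "uniformity = (INF e\<in>{0<..}. principal {(x :: quat, y). dist x y < e})"
    by (rule uniformity_quat_def)
  show "open U \<longleftrightarrow> (\<forall>x\<in>U. eventually (\<lambda>(x', y). x' = x \<longrightarrow> y \<in> U) uniformity)" for U :: "quat set"
    by (rule open_quat_def)
  show "inner p q = inner q p" by (simp add: inner_quat_def algebra_simps)
  show "inner (p + q) r = inner p r + inner q r" by (simp add: inner_quat_def algebra_simps)
  show "inner (a *\<^sub>R p) q = a * inner p q" by (simp add: inner_quat_def algebra_simps)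
  show "0 \<le> inner q q" by (simp add: inner_quat_def)
  show "inner q q = 0 \<longleftrightarrow> q = 0"
    by (auto simp: inner_quat_def quat_eq_iff add_nonneg_eq_0_iff)
  show "norm q = sqrt (inner q q)" by (rule norm_quat_def)
qed

end

instance quat :: real_normed_algebra_1
proof
  fix p q :: quat
  have "inner (p * q) (p * q) = inner p p * inner q q"
    unfolding inner_quat_def quat_mult_sel by algebra
  then show "norm (p * q) \<le> norm p * norm q"
    by (simp add: norm_quat_def real_sqrt_mult)
  show "norm (1 :: quat) = 1"
    by (simp add: norm_quat_def inner_quat_def)
qed

instantiation quat :: euclidean_space
begin

definition "Basis = {Quat 1 0 0 0, Quat 0 1 0 0, Quat 0 0 1 0, Quat 0 0 0 1}"

instance
proof
  fix u v q :: quat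
  show "(Basis :: quat set) \<noteq> {}" unfolding Basis_quat_def by blast
  show "finite (Basis :: quat set)" unfolding Basis_quat_def by blast
  show "u \<in> Basis \<Longrightarrow> v \<in> Basis \<Longrightarrow> inner u v = (if u = v then 1 else 0)"
    unfolding Basis_quat_def inner_quat_def
    by (elim insertE emptyE) simp_all
  show "(\<forall>u\<in>Basis. inner q u = 0) \<longleftrightarrow> q = 0"
    unfolding Basis_quat_def inner_quat_def quat_eq_iff by simp
qed

end


section \<open>Slice regular functions\<close>

definition imag_units :: "quat set" where
  "imag_units = {q. q\<^sup>2 = - 1}"

definition slice_plane :: "quat \<Rightarrow> quat set" where
  "slice_plane I = span {1, I}"

definition symmetric_slice_domain :: "quat set \<Rightarrow> bool" where
  "symmetric_slice_domain \<Omega> \<longleftrightarrow>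
     open \<Omega> \<and> connected \<Omega> \<and> \<Omega> \<inter> \<real> \<noteq> {} \<and>
     (\<forall>\<alpha> \<beta>. \<forall>I\<in>imag_units. of_real \<alpha> + I * of_real \<beta> \<in> \<Omega> \<longrightarrow>
        (\<forall>J\<in>imag_units. of_real \<alpha> + J * of_real \<beta> \<in> \<Omega>))"

definition dbar :: "quat \<Rightarrow> (quat \<Rightarrow> quat) \<Rightarrow> real \<Rightarrow> real \<Rightarrow> quat" where
  "dbar J f \<alpha> \<beta> = (1/2) *\<^sub>R
     (vector_derivative (\<lambda>s. f (of_real s + J * of_real \<beta>)) (at \<alpha>)
      + J * vector_derivative (\<lambda>t. f (of_real \<alpha> + J * of_real t)) (at \<beta>))"

text \<open>
  A function on \<open>\<Omega>\<close> is represented by a total function of which only the values on \<open>\<Omega>\<close>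
  matter. Holomorphy of the restriction to a slice means real (Frechet)
  differentiability in the two real variables together with the Cauchy-Riemann equation;
  mere existence of the partial derivatives would not suffice. The notion is meant for open
  \<open>\<Omega>\<close>, so that the unrestricted filters \<open>at\<close> only depend on values in \<open>\<Omega>\<close>.
\<close>

definition slice_regular :: "quat set \<Rightarrow> (quat \<Rightarrow> quat) \<Rightarrow> bool" where
  "slice_regular \<Omega> f \<longleftrightarrow>
     (\<forall>J\<in>imag_units. \<forall>\<alpha> \<beta>. of_real \<alpha> + J * of_real \<beta> \<in> \<Omega> \<longrightarrow>
        (\<lambda>(s, t). f (of_real s + J * of_real t)) differentiable at (\<alpha>, \<beta>) \<and>
        dbar J f \<alpha> \<beta> = 0)"

definition slice_preserving :: "quat set \<Rightarrow> (quat \<Rightarrow> quat) \<Rightarrow> bool" where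
  "slice_preserving \<Omega> f \<longleftrightarrow>
     slice_regular \<Omega> f \<and> (\<forall>I\<in>imag_units. f ` (\<Omega> \<inter> slice_plane I) \<subseteq> slice_plane I)"

definition plane_preserving :: "quat set \<Rightarrow> quat \<Rightarrow> (quat \<Rightarrow> quat) \<Rightarrow> bool" where
  "plane_preserving \<Omega> J f \<longleftrightarrow>
     slice_regular \<Omega> f \<and> f ` (\<Omega> \<inter> slice_plane J) \<subseteq> slice_plane J"

end

theory Submission
  imports Defs "HOL-Complex_Analysis.Conformal_Mappings"
begin

text \<open>
  Slice preserving functions take real values at real points. Hence if \<open>f + h\<close> preserves the
  plane of \<open>K\<^sub>0\<close>, then at every real point \<open>f\<^sub>1 I\<^sub>0 + h\<^sub>1 J\<^sub>0\<close> is a real multiple of \<open>K\<^sub>0\<close>. As \<open>I\<^sub>0\<close>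
  and \<open>J\<^sub>0\<close> are linearly independent and \<open>f\<^sub>1\<close> does not vanish identically, this places \<open>K\<^sub>0\<close> in
  their span and fixes the real ratio of \<open>f\<^sub>1\<close> to \<open>h\<^sub>1\<close> on the real axis; the identity principle
  extends the relation to the whole domain. The identity principle reduces to the complex one:
  on a slice, the \<open>\<complex>\<^sub>J\<close>-component of \<open>f L\<close> is holomorphic for every constant \<open>L\<close>.
\<close>

section \<open>Imaginary units and the planes they span\<close>

lemma imag_units_iff: "J \<in> imag_units \<longleftrightarrow> qRe J = 0 \<and> norm J = 1"
proof -
  have "(J\<^sup>2 = - 1) \<longleftrightarrow> qRe J = 0 \<and> (qIm1 J)\<^sup>2 + (qIm2 J)\<^sup>2 + (qIm3 J)\<^sup>2 = 1"
  proof
    assume "J\<^sup>2 = - 1"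
    then have re: "(qRe J)\<^sup>2 - (qIm1 J)\<^sup>2 - (qIm2 J)\<^sup>2 - (qIm3 J)\<^sup>2 = -1"
      and im: "qRe J * qIm1 J = 0" "qRe J * qIm2 J = 0" "qRe J * qIm3 J = 0"
      by (auto simp: power2_eq_square quat_eq_iff)
    have "qRe J = 0"
    proof (rule ccontr)
      assume "qRe J \<noteq> 0"
      \<comment> \<open>The imaginary components of \<open>J * J\<close> are
        \<open>2 * qRe J\<close> times those of \<open>J\<close>, so a nonzero real part kills the
        latter.\<close>
      then have "(qRe J)\<^sup>2 = -1"
        using re im by simp
      then show False
        using zero_le_power2[of "qRe J"] by linarith
    qed
    then show "qRe J = 0 \<and> (qIm1 J)\<^sup>2 + (qIm2 J)\<^sup>2 + (qIm3 J)\<^sup>2 = 1"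
      using re by simp
  next
    assume "qRe J = 0 \<and> (qIm1 J)\<^sup>2 + (qIm2 J)\<^sup>2 + (qIm3 J)\<^sup>2 = 1"
    then show "J\<^sup>2 = - 1"
      by (simp add: power2_eq_square quat_eq_iff)
  qed
  then show ?thesis
    by (auto simp: imag_units_def norm_quat_def inner_quat_def power2_eq_square)
qed

lemma imag_units_mult_self: "J \<in> imag_units \<Longrightarrow> J * J = - 1"
  by (simp add: imag_units_def power2_eq_square)

lemma uminus_imag_units: "J \<in> imag_units \<Longrightarrow> - J \<in> imag_units"
  by (simp add: imag_units_def)

lemma quat_of_real_sel [simp]:
  "qRe (of_real r) = r" "qIm1 (of_real r) = 0" "qIm2 (of_real r) = 0" "qIm3 (of_real r) = 0"
  by (simp_all add: of_real_def)

lemma slice_plane_iff: "q \<in> slice_plane J \<longleftrightarrow> (\<exists>x y. q = of_real x + y *\<^sub>R J)"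
proof -
  have "q \<in> slice_plane J \<longleftrightarrow> (\<exists>x y. q - of_real x = y *\<^sub>R J)"
    by (auto simp: slice_plane_def span_insert span_singleton of_real_def)
  also have "\<dots> \<longleftrightarrow> (\<exists>x y. q = of_real x + y *\<^sub>R J)"
    by (metis add.commute diff_eq_eq)
  finally show ?thesis .
qed

lemma of_real_in_slice_plane: "of_real x \<in> slice_plane J"
  unfolding slice_plane_iff by (rule exI[of _ x], rule exI[of _ 0]) simp

lemma self_in_slice_plane: "J \<in> slice_plane J"
  by (simp add: slice_plane_def span_base)

lemma add_in_slice_plane:
  "p \<in> slice_plane J \<Longrightarrow> q \<in> slice_plane J \<Longrightarrow> p + q \<in> slice_plane J"
  by (simp add: slice_plane_def span_add)

lemma diff_in_slice_plane:
  "p \<in> slice_plane J \<Longrightarrow> q \<in> slice_plane J \<Longrightarrow> p - q \<in> slice_plane J"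
  by (simp add: slice_plane_def span_diff)

lemma scaleR_in_slice_plane: "q \<in> slice_plane J \<Longrightarrow> r *\<^sub>R q \<in> slice_plane J"
  by (simp add: slice_plane_def span_scale)

lemma mult_in_slice_plane:
  assumes "J \<in> imag_units" "p \<in> slice_plane J" "q \<in> slice_plane J"
  shows "p * q \<in> slice_plane J"
proof -
  obtain x y x' y' where "p = of_real x + y *\<^sub>R J" "q = of_real x' + y' *\<^sub>R J"
    using assms unfolding slice_plane_iff by blast
  then have "p * q = of_real (x * x' - y * y') + (x * y' + y * x') *\<^sub>R J"
    using imag_units_mult_self[OF assms(1)]
    by (simp add: algebra_simps of_real_def)
  then show ?thesis
    unfolding slice_plane_iff by blast
qed

text \<open>Since both units have norm 1, a linear relation has coefficients of equal modulus. It is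
  therefore a multiple of \<open>I + J\<close> or of \<open>J - I\<close>, neither of which
  vanishes.\<close>

lemma imag_units_independent:
  assumes "I \<in> imag_units" "J \<in> imag_units" "I \<noteq> J" "I \<noteq> - J"
    and "r *\<^sub>R I + s *\<^sub>R J = 0"
  shows "r = 0 \<and> s = 0"
proof -
  have "norm (r *\<^sub>R I) = norm (s *\<^sub>R J)"
    using assms(5) by (metis add_eq_0_iff norm_minus_cancel)
  then have "\<bar>r\<bar> = \<bar>s\<bar>"
    using assms by (simp add: imag_units_iff)
  then consider "r = s" | "r = - s"
    by linarith
  then show ?thesis
  proof cases
    case 1
    then have "s *\<^sub>R (I + J) = 0"
      using assms(5) by (simp add: scaleR_add_right)
    then show ?thesis
      using 1 assms(4) by (auto simp: eq_neg_iff_add_eq_0)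
  next
    case 2
    then have "s *\<^sub>R (J - I) = 0"
      using assms(5) by (simp add: scaleR_diff_right)
    then show ?thesis
      using 2 assms(3) by auto
  qed
qed

text \<open>Comparing real parts leaves a relation between \<open>I\<close> and \<open>J\<close>,
  which independence makes trivial. A real point lies in every slice plane, so this is what forces a
  slice preserving function to be real there.\<close>

lemma slice_planes_Int:
  assumes "I \<in> imag_units" "J \<in> imag_units" "I \<noteq> J" "I \<noteq> - J"
    and "q \<in> slice_plane I" "q \<in> slice_plane J"
  shows "q \<in> \<real>"
proof -
  obtain x y x' y' where q: "q = of_real x + y *\<^sub>R I" "q = of_real x' + y' *\<^sub>R J"
    using assms unfolding slice_plane_iff by blast
  have "qRe q = x"
    using q(1) assms(1) by (simp add: imag_units_iff)
  moreover have "qRe q = x'"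
    using q(2) assms(2) by (simp add: imag_units_iff)
  ultimately have "x = x'"
    by simp
  with q have "y *\<^sub>R I + (- y') *\<^sub>R J = 0"
    by (simp add: eq_diff_eq)
  then have "y = 0"
    using imag_units_independent[OF assms(1-4)] by blast
  with q show ?thesis
    by simp
qed

section \<open>Slice regularity in terms of the total derivative\<close>

text \<open>Because \<open>J * J = - 1\<close>, the Cauchy-Riemann equation says exactly that the
  total derivative is \<open>(s, t)\<close> \<mapsto> \<open>(s + J t) d\<close>, where
  \<open>d\<close> is the derivative in the real direction. In this form sums, right multiples and
  the passage to complex coordinates are handled by the usual rules for derivatives.\<close>

lemma slice_regular_iff_has_derivative:
  "slice_regular \<Omega> f \<longleftrightarrow>
     (\<forall>J\<in>imag_units. \<forall>\<alpha> \<beta>. of_real \<alpha> + J * of_real \<beta> \<in> \<Omega> \<longrightarrow>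
        (\<exists>d. ((\<lambda>(s, t). f (of_real s + J * of_real t)) has_derivative
               (\<lambda>(s, t). s *\<^sub>R d + t *\<^sub>R (J * d))) (at (\<alpha>, \<beta>))))"
proof -
  have "((\<lambda>(s, t). f (of_real s + J * of_real t)) differentiable at (\<alpha>, \<beta>) \<and> dbar J f \<alpha> \<beta> = 0)
     \<longleftrightarrow> (\<exists>d. ((\<lambda>(s, t). f (of_real s + J * of_real t)) has_derivative
               (\<lambda>(s, t). s *\<^sub>R d + t *\<^sub>R (J * d))) (at (\<alpha>, \<beta>)))"
    if J: "J \<in> imag_units" for J \<alpha> \<beta>
  proof -
    let ?F = "\<lambda>(s, t). f (of_real s + J * of_real t)"
    have JJ: "J * (J * q) = - q" for q
      using imag_units_mult_self[OF J] by (metis mult.assoc mult_minus1)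
    \<comment> \<open>The two partial derivatives in \<open>dbar\<close> are the values of
      \<open>D\<close> on the standard basis, by the chain rule along the coordinate lines.\<close>
    have dbar: "dbar J f \<alpha> \<beta> = (1/2) *\<^sub>R (D (1, 0) + J * D (0, 1))"
      if D: "(?F has_derivative D) (at (\<alpha>, \<beta>))" for D
    proof -
      have lin: "linear D"
        using D by (rule has_derivative_linear)
      have "((\<lambda>s. (s, \<beta>)) has_derivative (\<lambda>x. (x, 0))) (at \<alpha>)"
        by (intro has_derivative_Pair has_derivative_ident has_derivative_const)
      from has_derivative_compose[OF this D]
      have "((\<lambda>s. ?F (s, \<beta>)) has_derivative (\<lambda>x. D (x, 0))) (at \<alpha>)" .
      moreover have "(\<lambda>x. D (x, 0)) = (\<lambda>x. x *\<^sub>R D (1, 0))"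
      proof
        show "D (x, 0) = x *\<^sub>R D (1, 0)" for x
          using linear_scale[OF lin, of x "(1, 0)"] by simp
      qed
      ultimately have s: "((\<lambda>s. f (of_real s + J * of_real \<beta>)) has_vector_derivative D (1, 0)) (at \<alpha>)"
        by (simp only: has_vector_derivative_def prod.case)
      have "((\<lambda>t. (\<alpha>, t)) has_derivative (\<lambda>x. (0, x))) (at \<beta>)"
        by (intro has_derivative_Pair has_derivative_ident has_derivative_const)
      from has_derivative_compose[OF this D]
      have "((\<lambda>t. ?F (\<alpha>, t)) has_derivative (\<lambda>x. D (0, x))) (at \<beta>)" .
      moreover have "(\<lambda>x. D (0, x)) = (\<lambda>x. x *\<^sub>R D (0, 1))"
      proof
        show "D (0, x) = x *\<^sub>R D (0, 1)" for x
          using linear_scale[OF lin, of x "(0, 1)"] by simp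
      qed
      ultimately have t: "((\<lambda>t. f (of_real \<alpha> + J * of_real t)) has_vector_derivative D (0, 1)) (at \<beta>)"
        by (simp only: has_vector_derivative_def prod.case)
      show ?thesis
        by (simp add: dbar_def vector_derivative_at[OF s] vector_derivative_at[OF t])
    qed
    show ?thesis
    proof
      assume "?F differentiable at (\<alpha>, \<beta>) \<and> dbar J f \<alpha> \<beta> = 0"
      then obtain D where D: "(?F has_derivative D) (at (\<alpha>, \<beta>))" and "dbar J f \<alpha> \<beta> = 0"
        by (auto simp: differentiable_def)
      with dbar[OF D] have "D (1, 0) = - (J * D (0, 1))"
        by (simp add: eq_neg_iff_add_eq_0)
      then have D01: "D (0, 1) = J * D (1, 0)"
        by (simp add: JJ)
      have lin: "linear D"
        using D by (rule has_derivative_linear)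
      have D_eq: "D (s, t) = s *\<^sub>R D (1, 0) + t *\<^sub>R (J * D (1, 0))" for s t
        using linear_add[OF lin, of "s *\<^sub>R (1, 0)" "t *\<^sub>R (0, 1)"]
          linear_scale[OF lin, of s "(1, 0)"] linear_scale[OF lin, of t "(0, 1)"] D01 by simp
      have "D = (\<lambda>(s, t). s *\<^sub>R D (1, 0) + t *\<^sub>R (J * D (1, 0)))"
      proof
        show "D p = (case p of (s, t) \<Rightarrow> s *\<^sub>R D (1, 0) + t *\<^sub>R (J * D (1, 0)))" for p
          using D_eq[of "fst p" "snd p"] by (simp only: case_prod_unfold prod.collapse)
      qed
      with D show "\<exists>d. (?F has_derivative (\<lambda>(s, t). s *\<^sub>R d + t *\<^sub>R (J * d))) (at (\<alpha>, \<beta>))"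
        by metis
    next
      assume "\<exists>d. (?F has_derivative (\<lambda>(s, t). s *\<^sub>R d + t *\<^sub>R (J * d))) (at (\<alpha>, \<beta>))"
      then obtain d where d: "(?F has_derivative (\<lambda>(s, t). s *\<^sub>R d + t *\<^sub>R (J * d))) (at (\<alpha>, \<beta>))" ..
      show "?F differentiable at (\<alpha>, \<beta>) \<and> dbar J f \<alpha> \<beta> = 0"
        using dbar[OF d] d by (auto simp: differentiable_def JJ)
    qed
  qed
  then show ?thesis
    unfolding slice_regular_def by blast
qed

lemma slice_regular_add:
  assumes "slice_regular \<Omega> f" "slice_regular \<Omega> g"
  shows "slice_regular \<Omega> (\<lambda>q. f q + g q)"
  unfolding slice_regular_iff_has_derivative
proof (intro ballI allI impI)
  fix J \<alpha> \<beta> assume "J \<in> imag_units" "of_real \<alpha> + J * of_real \<beta> \<in> \<Omega>"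
  then obtain d e where
    "((\<lambda>(s, t). f (of_real s + J * of_real t)) has_derivative
        (\<lambda>(s, t). s *\<^sub>R d + t *\<^sub>R (J * d))) (at (\<alpha>, \<beta>))"
    "((\<lambda>(s, t). g (of_real s + J * of_real t)) has_derivative
        (\<lambda>(s, t). s *\<^sub>R e + t *\<^sub>R (J * e))) (at (\<alpha>, \<beta>))"
    using assms unfolding slice_regular_iff_has_derivative by meson
  from has_derivative_add[OF this]
  have "((\<lambda>(s, t). f (of_real s + J * of_real t) + g (of_real s + J * of_real t)) has_derivative
        (\<lambda>(s, t). s *\<^sub>R (d + e) + t *\<^sub>R (J * (d + e)))) (at (\<alpha>, \<beta>))"
    by (simp add: case_prod_unfold algebra_simps)
  then show "\<exists>d. ((\<lambda>(s, t). f (of_real s + J * of_real t) + g (of_real s + J * of_real t))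
      has_derivative (\<lambda>(s, t). s *\<^sub>R d + t *\<^sub>R (J * d))) (at (\<alpha>, \<beta>))" ..
qed

text \<open>A constant on the right passes through the left multiplication by \<open>J\<close> by
  associativity alone. Letting \<open>L\<close> vary later gives access to all four components of
  \<open>f\<close>.\<close>

lemma slice_regular_mult_right:
  assumes "slice_regular \<Omega> f"
  shows "slice_regular \<Omega> (\<lambda>q. f q * L)"
  unfolding slice_regular_iff_has_derivative
proof (intro ballI allI impI)
  fix J \<alpha> \<beta> assume "J \<in> imag_units" "of_real \<alpha> + J * of_real \<beta> \<in> \<Omega>"
  then obtain d where
    "((\<lambda>(s, t). f (of_real s + J * of_real t)) has_derivative
        (\<lambda>(s, t). s *\<^sub>R d + t *\<^sub>R (J * d))) (at (\<alpha>, \<beta>))"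
    using assms unfolding slice_regular_iff_has_derivative by meson
  from has_derivative_mult_left[OF this, of L]
  have "((\<lambda>(s, t). f (of_real s + J * of_real t) * L) has_derivative
        (\<lambda>(s, t). s *\<^sub>R (d * L) + t *\<^sub>R (J * (d * L)))) (at (\<alpha>, \<beta>))"
    by (simp add: case_prod_unfold algebra_simps)
  then show "\<exists>d. ((\<lambda>(s, t). f (of_real s + J * of_real t) * L)
      has_derivative (\<lambda>(s, t). s *\<^sub>R d + t *\<^sub>R (J * d))) (at (\<alpha>, \<beta>))" ..
qed

section \<open>Complex coordinates on a slice\<close>

definition slice_point :: "quat \<Rightarrow> complex \<Rightarrow> quat" where
  "slice_point J z = of_real (Re z) + J * of_real (Im z)"

text \<open>For an imaginary unit \<open>J\<close> this is the orthogonal projection to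
  \<open>slice_plane J\<close>, read as a complex number.\<close>

definition slice_coord :: "quat \<Rightarrow> quat \<Rightarrow> complex" where
  "slice_coord J q = Complex (qRe q) (inner q J)"

lemma bounded_linear_slice_coord: "bounded_linear (slice_coord J)"
  by (rule linear_conv_bounded_linear[THEN iffD1], rule linearI)
    (simp_all add: slice_coord_def complex_eq_iff inner_add_left)

text \<open>Left multiplication by \<open>J\<close> preserves both \<open>slice_plane J\<close> and
  its orthogonal complement, so the projection turns it into multiplication by the complex
  unit.\<close>

lemma slice_coord_mult_left:
  assumes "J \<in> imag_units"
  shows "slice_coord J (J * q) = \<i> * slice_coord J q"
proof -
  have J: "qRe J = 0" "inner J J = 1"
    using assms by (simp_all add: imag_units_iff norm_eq_1)
  have "inner (J * q) J = inner J J * qRe q"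
    using J(1) by (simp add: inner_quat_def algebra_simps)
  moreover have "qRe (J * q) = - inner q J"
    using J(1) by (simp add: inner_quat_def algebra_simps)
  ultimately show ?thesis
    using J by (simp add: slice_coord_def complex_eq_iff)
qed

lemma holomorphic_slice_coord:
  assumes f: "slice_regular \<Omega> f" and J: "J \<in> imag_units"
  shows "(\<lambda>z. slice_coord J (f (slice_point J z))) holomorphic_on {z. slice_point J z \<in> \<Omega>}"
  unfolding holomorphic_on_def
proof
  fix z assume "z \<in> {z. slice_point J z \<in> \<Omega>}"
  then obtain d where d: "((\<lambda>(s, t). f (of_real s + J * of_real t)) has_derivative
        (\<lambda>(s, t). s *\<^sub>R d + t *\<^sub>R (J * d))) (at (Re z, Im z))"
    using f J unfolding slice_regular_iff_has_derivative slice_point_def by blast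
  have "((\<lambda>z. (Re z, Im z)) has_derivative (\<lambda>w. (Re w, Im w))) (at z)"
    by (auto intro!: derivative_eq_intros)
  from has_derivative_compose[OF this d]
  have "((\<lambda>z. f (slice_point J z)) has_derivative (\<lambda>w. Re w *\<^sub>R d + Im w *\<^sub>R (J * d))) (at z)"
    by (simp add: slice_point_def)
  from bounded_linear.has_derivative[OF bounded_linear_slice_coord this]
  have "((\<lambda>z. slice_coord J (f (slice_point J z))) has_derivative
      (\<lambda>w. slice_coord J (Re w *\<^sub>R d + Im w *\<^sub>R (J * d)))) (at z)" .
  \<comment> \<open>The coordinate map replaces \<open>J * d\<close> by \<open>\<i>\<close> times
    the coordinate of \<open>d\<close>, so the real derivative becomes complex
    multiplication.\<close>
  moreover have "slice_coord J (Re w *\<^sub>R d + Im w *\<^sub>R (J * d)) = slice_coord J d * w" for w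
    using linear_add[OF bounded_linear.linear[OF bounded_linear_slice_coord]]
      linear_scale[OF bounded_linear.linear[OF bounded_linear_slice_coord]]
      slice_coord_mult_left[OF J]
    by (simp add: complex_eq_iff algebra_simps)
  ultimately have "((\<lambda>z. slice_coord J (f (slice_point J z))) has_field_derivative slice_coord J d) (at z)"
    by (simp add: has_field_derivative_def)
  then show "(\<lambda>z. slice_coord J (f (slice_point J z))) field_differentiable
      at z within {z. slice_point J z \<in> \<Omega>}"
    using field_differentiable_at_within field_differentiable_def by blast
qed

section \<open>Slices of a symmetric slice domain\<close>

lemma continuous_slice_point: "continuous_on A (slice_point J)"
  unfolding slice_point_def by (intro continuous_intros)

lemma slice_point_of_real: "slice_point J (of_real x) = of_real x"
  by (simp add: slice_point_def)

text \<open>The unit is the normalised imaginary part of \<open>q\<close>; for real \<open>q\<close>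
  any unit will do. The imaginary coordinate is taken nonnegative, so that the complex number is a
  continuous function of \<open>q\<close>.\<close>

lemma obtain_slice:
  obtains J where "J \<in> imag_units"
    "q = slice_point J (Complex (qRe q) (norm (q - of_real (qRe q))))"
proof (cases "q = of_real (qRe q)")
  case True
  have "Quat 0 1 0 0 \<in> imag_units"
    by (simp add: imag_units_iff norm_quat_def inner_quat_def)
  moreover have "q = slice_point (Quat 0 1 0 0) (Complex (qRe q) (norm (q - of_real (qRe q))))"
    using True by (simp add: slice_point_def)
  ultimately show ?thesis
    by (rule that)
next
  case False
  define n where "n = norm (q - of_real (qRe q))"
  have "n \<noteq> 0"
    using False by (simp add: n_def)
  have "inverse n *\<^sub>R (q - of_real (qRe q)) \<in> imag_units"
    using \<open>n \<noteq> 0\<close> by (simp add: imag_units_iff) (simp add: n_def)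
  moreover have "q = slice_point (inverse n *\<^sub>R (q - of_real (qRe q))) (Complex (qRe q) n)"
    using \<open>n \<noteq> 0\<close> by (simp add: slice_point_def of_real_def)
  ultimately show ?thesis
    using that unfolding n_def by blast
qed

lemma symmetric_slice_domainD:
  assumes "symmetric_slice_domain \<Omega>" "slice_point I z \<in> \<Omega>" "I \<in> imag_units" "J \<in> imag_units"
  shows "slice_point J z \<in> \<Omega>"
  using assms unfolding symmetric_slice_domain_def slice_point_def by blast

text \<open>
  A slice is the image \<open>P\<close> of \<open>\<Omega>\<close> under \<open>q \<mapsto> Re q + i |Im q|\<close> together with its complex
  conjugate; both are connected, and they share the real points of \<open>\<Omega>\<close>.
\<close>

lemma connected_slice:
  assumes \<Omega>: "symmetric_slice_domain \<Omega>" and J: "J \<in> imag_units"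
  shows "connected {z. slice_point J z \<in> \<Omega>}"
proof -
  define \<psi> where "\<psi> q = Complex (qRe q) (norm (q - of_real (qRe q)))" for q
  have "linear qRe"
    by (rule linearI) simp_all
  then have "continuous_on \<Omega> qRe"
    by (simp add: linear_continuous_on linear_conv_bounded_linear)
  then have "continuous_on \<Omega> \<psi>"
    unfolding \<psi>_def Complex_eq by (intro continuous_intros)
  then have P: "connected (\<psi> ` \<Omega>)"
    using \<Omega> connected_continuous_image unfolding symmetric_slice_domain_def by blast
  then have Q: "connected (cnj ` \<psi> ` \<Omega>)"
    by (rule connected_continuous_image[rotated]) (intro continuous_intros)
  obtain x where x: "of_real x \<in> \<Omega>"
    using \<Omega> unfolding symmetric_slice_domain_def by (auto elim!: Reals_cases)
  have "\<psi> (of_real x) = of_real x"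
    by (simp add: \<psi>_def complex_eq_iff)
  then have "of_real x \<in> \<psi> ` \<Omega>" "of_real x \<in> cnj ` \<psi> ` \<Omega>"
    using x by (metis imageI, metis imageI complex_cnj_complex_of_real)
  then have "connected (\<psi> ` \<Omega> \<union> cnj ` \<psi> ` \<Omega>)"
    using P Q by (intro connected_Un) auto
  moreover have "{z. slice_point J z \<in> \<Omega>} = \<psi> ` \<Omega> \<union> cnj ` \<psi> ` \<Omega>"
  proof (intro equalityI subsetI)
    fix z assume z: "z \<in> {z. slice_point J z \<in> \<Omega>}"
    have "slice_point J z - of_real (qRe (slice_point J z)) = Im z *\<^sub>R J"
      using J by (simp add: slice_point_def imag_units_iff of_real_def)
    then have "\<psi> (slice_point J z) = Complex (Re z) \<bar>Im z\<bar>"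
      using J by (simp add: \<psi>_def imag_units_iff) (simp add: slice_point_def imag_units_iff)
    then have "z = \<psi> (slice_point J z) \<or> z = cnj (\<psi> (slice_point J z))"
      by (auto simp: complex_eq_iff abs_if)
    then show "z \<in> \<psi> ` \<Omega> \<union> cnj ` \<psi> ` \<Omega>"
      using z by blast
  next
    fix z assume "z \<in> \<psi> ` \<Omega> \<union> cnj ` \<psi> ` \<Omega>"
    then obtain q where q: "q \<in> \<Omega>" "z = \<psi> q \<or> z = cnj (\<psi> q)"
      by blast
    obtain I where I: "I \<in> imag_units" "q = slice_point I (\<psi> q)"
      unfolding \<psi>_def by (rule obtain_slice)
    \<comment> \<open>Conjugating the coordinate while negating the unit fixes the quaternion. Hence
      both \<open>\<psi> q\<close> and its conjugate are coordinates of \<open>q\<close> on some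
      slice, and symmetry of \<open>\<Omega>\<close> carries them over to the slice of
      \<open>J\<close>.\<close>
    have "slice_point (- I) (cnj (\<psi> q)) = q"
      using I(2) by (simp add: slice_point_def)
    then show "z \<in> {z. slice_point J z \<in> \<Omega>}"
      using q I J symmetric_slice_domainD[OF \<Omega>] uminus_imag_units by (metis mem_Collect_eq)
  qed
  ultimately show ?thesis
    by simp
qed

section \<open>The identity principle\<close>

theorem slice_regular_identity_principle:
  assumes \<Omega>: "symmetric_slice_domain \<Omega>" and f: "slice_regular \<Omega> f"
    and zero: "\<And>x. of_real x \<in> \<Omega> \<Longrightarrow> f (of_real x) = 0"
    and q: "q \<in> \<Omega>"
  shows "f q = 0"
proof -
  obtain J z where J: "J \<in> imag_units" and z: "q = slice_point J z"
    using obtain_slice by blast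
  let ?S = "{z. slice_point J z \<in> \<Omega>}"
  have S: "open ?S"
    using \<Omega> open_vimage[OF _ continuous_slice_point, of \<Omega> J]
    unfolding symmetric_slice_domain_def vimage_def by blast
  obtain x where "of_real x \<in> \<Omega>"
    using \<Omega> unfolding symmetric_slice_domain_def by (auto elim!: Reals_cases)
  then have xS: "of_real x \<in> ?S"
    by (simp add: slice_point_of_real)
  \<comment> \<open>The slice is open, so it contains real points arbitrarily close to
    \<open>x\<close>; the zeros on the real axis therefore accumulate inside it.\<close>
  have limpt: "(of_real x :: complex) islimpt ?S \<inter> \<real>"
  proof -
    obtain e where e: "e > 0" "ball (of_real x) e \<subseteq> ?S"
      using S xS open_contains_ball by blast
    show ?thesis
      unfolding islimpt_approachable
    proof (intro allI impI)
      fix \<epsilon> :: real assume "\<epsilon> > 0"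
      define \<delta> where "\<delta> = min e \<epsilon> / 2"
      have \<delta>: "0 < \<delta>" "\<delta> < e" "\<delta> < \<epsilon>"
        using e \<open>\<epsilon> > 0\<close> by (auto simp: \<delta>_def min_def)
      have "dist (of_real (x + \<delta>) :: complex) (of_real x) = \<delta>"
        using \<delta> by (simp add: dist_norm)
      then have "of_real (x + \<delta>) \<in> ?S \<inter> \<real> \<and> (of_real (x + \<delta>) :: complex) \<noteq> of_real x
          \<and> dist (of_real (x + \<delta>) :: complex) (of_real x) < \<epsilon>"
        using \<delta> subsetD[OF e(2), of "of_real (x + \<delta>)"] by (simp add: dist_commute)
      then show "\<exists>y\<in>?S \<inter> \<real>. y \<noteq> of_real x \<and> dist y (of_real x) < \<epsilon>"
        by blast
    qed
  qed
  have "slice_coord J (f q * L) = 0" for L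
  proof -
    have "slice_coord J (f (slice_point J z) * L) = 0"
    proof (rule analytic_continuation[of "\<lambda>z. slice_coord J (f (slice_point J z) * L)" ?S "?S \<inter> \<real>" "of_real x"])
      show "(\<lambda>z. slice_coord J (f (slice_point J z) * L)) holomorphic_on ?S"
        by (rule holomorphic_slice_coord[OF slice_regular_mult_right[OF f] J])
      show "slice_coord J (f (slice_point J w) * L) = 0" if "w \<in> ?S \<inter> \<real>" for w
        using that zero by (auto elim!: Reals_cases simp: slice_point_of_real slice_coord_def zero_complex.code)
    qed (use S connected_slice[OF \<Omega> J] limpt xS q z in auto)
    then show ?thesis
      by (simp add: z)
  qed
  \<comment> \<open>Taking \<open>L\<close> to be the conjugate of \<open>f q\<close> makes the real
    part of \<open>f q * L\<close> equal to the squared norm of \<open>f q\<close>.\<close>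
  from this[of "Quat (qRe (f q)) (- qIm1 (f q)) (- qIm2 (f q)) (- qIm3 (f q))"]
  have "inner (f q) (f q) = 0"
    by (simp add: slice_coord_def complex_eq_iff inner_quat_def)
  then show ?thesis
    by simp
qed

section \<open>Characterisation of the planes preserved by the sum\<close>

lemma slice_preserving_cong:
  assumes "slice_preserving \<Omega> g" "slice_regular \<Omega> f" "\<And>q. q \<in> \<Omega> \<Longrightarrow> f q = g q"
  shows "slice_preserving \<Omega> f"
  using assms unfolding slice_preserving_def by (auto simp: image_subset_iff)

lemma slice_regular_scaleR_diff:
  assumes "slice_regular \<Omega> f" "slice_regular \<Omega> g"
  shows "slice_regular \<Omega> (\<lambda>q. b *\<^sub>R f q - a *\<^sub>R g q)"
  using slice_regular_add[OF assms(1)[THEN slice_regular_mult_right, of "of_real b"]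
      assms(2)[THEN slice_regular_mult_right, of "of_real (- a)"]]
  by (simp add: of_real_def)

lemma slice_preservingD:
  assumes "slice_preserving \<Omega> f" "J \<in> imag_units" "q \<in> \<Omega>" "q \<in> slice_plane J"
  shows "f q \<in> slice_plane J"
  using assms unfolding slice_preserving_def by blast

theorem proposition4p1:
  fixes \<Omega> :: "quat set" and I\<^sub>0 J\<^sub>0 K\<^sub>0 :: quat
    and f h f\<^sub>0 f\<^sub>1 h\<^sub>0 h\<^sub>1 :: "quat \<Rightarrow> quat"
  assumes "symmetric_slice_domain \<Omega>"
    and "I\<^sub>0 \<in> imag_units" and "J\<^sub>0 \<in> imag_units"
    and "I\<^sub>0 \<noteq> J\<^sub>0" and "I\<^sub>0 \<noteq> - J\<^sub>0"
    and "slice_regular \<Omega> f" and "slice_regular \<Omega> h"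
    and "\<not> slice_preserving \<Omega> f" and "\<not> slice_preserving \<Omega> h"
    and "plane_preserving \<Omega> I\<^sub>0 f" and "plane_preserving \<Omega> J\<^sub>0 h"
    and "slice_preserving \<Omega> f\<^sub>0" and "slice_preserving \<Omega> f\<^sub>1"
    and "slice_preserving \<Omega> h\<^sub>0" and "slice_preserving \<Omega> h\<^sub>1"
    and "\<And>q. q \<in> \<Omega> \<Longrightarrow> f q = f\<^sub>0 q + f\<^sub>1 q * I\<^sub>0"
    and "\<And>q. q \<in> \<Omega> \<Longrightarrow> h q = h\<^sub>0 q + h\<^sub>1 q * J\<^sub>0"
    and "K\<^sub>0 \<in> imag_units"
  shows "plane_preserving \<Omega> K\<^sub>0 (\<lambda>q. f q + h q) \<longleftrightarrow>
    (\<exists>a b :: real. a \<noteq> 0 \<and> b \<noteq> 0 \<and> K\<^sub>0 = a *\<^sub>R I\<^sub>0 + b *\<^sub>R J\<^sub>0 \<and>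
       (\<forall>q\<in>\<Omega>. b *\<^sub>R f\<^sub>1 q - a *\<^sub>R h\<^sub>1 q = 0))"
proof -
  note \<Omega> = assms(1) and I\<^sub>0 = assms(2) and J\<^sub>0 = assms(3) and K\<^sub>0 = assms(18)
    and f_eq = assms(16) and h_eq = assms(17)
  note indep = imag_units_independent[OF assms(2-5)]
  have reg: "slice_regular \<Omega> f\<^sub>1" "slice_regular \<Omega> h\<^sub>1"
    using assms(13,15) by (simp_all add: slice_preserving_def)
  \<comment> \<open>If \<open>f\<^sub>1\<close> vanished on \<open>\<Omega>\<close>, then
    \<open>f\<close> would agree there with \<open>f\<^sub>0\<close> and be slice preserving;
    likewise for \<open>h\<close>.\<close>
  have nz: "\<exists>q\<in>\<Omega>. f\<^sub>1 q \<noteq> 0" "\<exists>q\<in>\<Omega>. h\<^sub>1 q \<noteq> 0"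
    using slice_preserving_cong[OF assms(12,6)] slice_preserving_cong[OF assms(14,7)]
      assms(8,9) f_eq h_eq by force+
  show ?thesis
  proof
    assume pres: "plane_preserving \<Omega> K\<^sub>0 (\<lambda>q. f q + h q)"
    have real: "\<exists>r s c. f\<^sub>1 (of_real x) = of_real r \<and> h\<^sub>1 (of_real x) = of_real s \<and>
        r *\<^sub>R I\<^sub>0 + s *\<^sub>R J\<^sub>0 = c *\<^sub>R K\<^sub>0" if x: "of_real x \<in> \<Omega>" for x
    proof -
      let ?x = "of_real x :: quat"
      have "g ?x \<in> \<real>" if "slice_preserving \<Omega> g" for g
        using slice_planes_Int[OF assms(2-5)]
          slice_preservingD[OF that _ x of_real_in_slice_plane] I\<^sub>0 J\<^sub>0 by blast
      then obtain r s where rs: "f\<^sub>1 ?x = of_real r" "h\<^sub>1 ?x = of_real s"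
        using assms(13,15) by (meson Reals_cases)
      have "f ?x + h ?x \<in> slice_plane K\<^sub>0"
        using pres x of_real_in_slice_plane unfolding plane_preserving_def by blast
      moreover have "f\<^sub>0 ?x + h\<^sub>0 ?x \<in> slice_plane K\<^sub>0"
        by (intro add_in_slice_plane slice_preservingD[OF assms(12)]
            slice_preservingD[OF assms(14)] K\<^sub>0 x of_real_in_slice_plane)
      ultimately have "(f ?x + h ?x) - (f\<^sub>0 ?x + h\<^sub>0 ?x) \<in> slice_plane K\<^sub>0"
        by (rule diff_in_slice_plane)
      moreover have "(f ?x + h ?x) - (f\<^sub>0 ?x + h\<^sub>0 ?x) = r *\<^sub>R I\<^sub>0 + s *\<^sub>R J\<^sub>0"
        using f_eq[OF x] h_eq[OF x] rs by (simp add: of_real_def)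
      ultimately obtain u c where uc: "r *\<^sub>R I\<^sub>0 + s *\<^sub>R J\<^sub>0 = of_real u + c *\<^sub>R K\<^sub>0"
        unfolding slice_plane_iff by auto
      \<comment> \<open>All three units are purely imaginary, so the real part of the relation is
        just \<open>u\<close>.\<close>
      from arg_cong[OF this, of qRe] have "u = 0"
        using I\<^sub>0 J\<^sub>0 K\<^sub>0 by (simp add: imag_units_iff)
      with uc rs show ?thesis
        by auto
    qed
    \<comment> \<open>By the identity principle a function vanishing at all real points of
      \<open>\<Omega>\<close> is zero, which \<open>f\<^sub>1\<close> is not.\<close>
    obtain x where x: "of_real x \<in> \<Omega>" "f\<^sub>1 (of_real x) \<noteq> 0"
      using slice_regular_identity_principle[OF \<Omega> reg(1)] nz(1) by blast
    obtain r s c where rs: "f\<^sub>1 (of_real x) = of_real r" "r *\<^sub>R I\<^sub>0 + s *\<^sub>R J\<^sub>0 = c *\<^sub>R K\<^sub>0"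
      using real[OF x(1)] by blast
    \<comment> \<open>Otherwise independence would give \<open>r = 0\<close>, contrary to the choice
      of \<open>x\<close>.\<close>
    have "c \<noteq> 0"
      using indep[of r s] rs x(2) by auto
    define a b where "a = r / c" and "b = s / c"
    have "(1 / c) *\<^sub>R (c *\<^sub>R K\<^sub>0) = a *\<^sub>R I\<^sub>0 + b *\<^sub>R J\<^sub>0"
      unfolding rs(2)[symmetric] a_def b_def by (simp add: scaleR_add_right)
    then have K: "K\<^sub>0 = a *\<^sub>R I\<^sub>0 + b *\<^sub>R J\<^sub>0"
      using \<open>c \<noteq> 0\<close> by simp
    have ratio: "b *\<^sub>R f\<^sub>1 q - a *\<^sub>R h\<^sub>1 q = 0" if "q \<in> \<Omega>" for q
    proof (rule slice_regular_identity_principle[OF \<Omega> slice_regular_scaleR_diff[OF reg] _ that])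
      fix y assume "of_real y \<in> \<Omega>"
      from real[OF this] obtain r s c where y: "f\<^sub>1 (of_real y) = of_real r"
          "h\<^sub>1 (of_real y) = of_real s" "r *\<^sub>R I\<^sub>0 + s *\<^sub>R J\<^sub>0 = c *\<^sub>R K\<^sub>0"
        by blast
      \<comment> \<open>Here \<open>r\<close>, \<open>s\<close>, \<open>c\<close> belong to the new
        point \<open>y\<close>, while \<open>a\<close> and \<open>b\<close> remain fixed. Uniqueness
        of coordinates makes \<open>(r, s)\<close> the multiple \<open>c\<close> of
        \<open>(a, b)\<close>, whence \<open>b * r = a * s\<close>.\<close>
      have "(r - c * a) *\<^sub>R I\<^sub>0 + (s - c * b) *\<^sub>R J\<^sub>0 = 0"
        using y(3) unfolding K by (simp add: algebra_simps)
      then have "r = c * a" "s = c * b"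
        using indep[of "r - c * a" "s - c * b"] by simp_all
      then show "b *\<^sub>R f\<^sub>1 (of_real y) - a *\<^sub>R h\<^sub>1 (of_real y) = 0"
        by (simp add: y(1,2)) (simp add: of_real_def)
    qed
    \<comment> \<open>The unit \<open>K\<^sub>0\<close> is nonzero, so \<open>a\<close> and
      \<open>b\<close> do not both vanish. If only \<open>a\<close> did, the relation would make
      \<open>f\<^sub>1\<close> zero on \<open>\<Omega>\<close>; if only \<open>b\<close> did,
      \<open>h\<^sub>1\<close>.\<close>
    have "a \<noteq> 0 \<or> b \<noteq> 0"
      using K K\<^sub>0 by (auto simp: imag_units_iff)
    then have "a \<noteq> 0" "b \<noteq> 0"
      using ratio nz by fastforce+
    with K ratio show "\<exists>a b. a \<noteq> 0 \<and> b \<noteq> 0 \<and> K\<^sub>0 = a *\<^sub>R I\<^sub>0 + b *\<^sub>R J\<^sub>0 \<and>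
        (\<forall>q\<in>\<Omega>. b *\<^sub>R f\<^sub>1 q - a *\<^sub>R h\<^sub>1 q = 0)"
      by blast
  next
    assume "\<exists>a b. a \<noteq> 0 \<and> b \<noteq> 0 \<and> K\<^sub>0 = a *\<^sub>R I\<^sub>0 + b *\<^sub>R J\<^sub>0 \<and>
        (\<forall>q\<in>\<Omega>. b *\<^sub>R f\<^sub>1 q - a *\<^sub>R h\<^sub>1 q = 0)"
    then obtain a b where ab: "a \<noteq> 0" "K\<^sub>0 = a *\<^sub>R I\<^sub>0 + b *\<^sub>R J\<^sub>0"
      and ratio: "\<And>q. q \<in> \<Omega> \<Longrightarrow> b *\<^sub>R f\<^sub>1 q = a *\<^sub>R h\<^sub>1 q"
      by auto
    have "f q + h q \<in> slice_plane K\<^sub>0" if q: "q \<in> \<Omega>" "q \<in> slice_plane K\<^sub>0" for q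
    proof -
      \<comment> \<open>Scaling by \<open>a\<close> lets the relation trade \<open>h\<^sub>1\<close>
        for \<open>f\<^sub>1\<close>, which then factors out on the left and leaves
        \<open>K\<^sub>0\<close> on the right.\<close>
      have "a *\<^sub>R (f\<^sub>1 q * I\<^sub>0 + h\<^sub>1 q * J\<^sub>0) = a *\<^sub>R (f\<^sub>1 q * I\<^sub>0) + (b *\<^sub>R f\<^sub>1 q) * J\<^sub>0"
        by (simp add: ratio[OF q(1)] scaleR_add_right)
      also have "\<dots> = f\<^sub>1 q * K\<^sub>0"
        by (simp add: ab(2) distrib_left)
      finally have "a *\<^sub>R (f\<^sub>1 q * I\<^sub>0 + h\<^sub>1 q * J\<^sub>0) = f\<^sub>1 q * K\<^sub>0" .
      from arg_cong[OF this, of "\<lambda>p. (1 / a) *\<^sub>R p"]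
      have "f\<^sub>1 q * I\<^sub>0 + h\<^sub>1 q * J\<^sub>0 = (1 / a) *\<^sub>R (f\<^sub>1 q * K\<^sub>0)"
        using ab(1) by simp
      then have "f q + h q = (f\<^sub>0 q + h\<^sub>0 q) + (1 / a) *\<^sub>R (f\<^sub>1 q * K\<^sub>0)"
        by (simp add: f_eq[OF q(1)] h_eq[OF q(1)] algebra_simps)
      moreover have "f\<^sub>0 q \<in> slice_plane K\<^sub>0" "f\<^sub>1 q \<in> slice_plane K\<^sub>0" "h\<^sub>0 q \<in> slice_plane K\<^sub>0"
        using assms(12-14)[THEN slice_preservingD, OF K\<^sub>0 q] by blast+
      ultimately show ?thesis
        by (simp add: add_in_slice_plane scaleR_in_slice_plane mult_in_slice_plane K\<^sub>0
            self_in_slice_plane)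
    qed
    then show "plane_preserving \<Omega> K\<^sub>0 (\<lambda>q. f q + h q)"
      unfolding plane_preserving_def using slice_regular_add[OF assms(6,7)] by blast
  qed
qed

end
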